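(* Let $\mathcal{K}\subseteq[0,1]^n$ be a convex set with diameter $D$, let $\beta>0$, and let $F\colon[0,1]^n\to\mathbb{R}_{\geq0}$ be a non-negative $\beta$-smooth DR-submodular function. Let $T\geq 0$ be an integer and $\varepsilon\in(0,1)$, and let $\mathbf{w}$ be the output of the algorithm NMFW$(T,\varepsilon)$ described in the context. Then $\mathbf{w}\in\mathcal{K}$ and \[ F(\mathbf{w})\geq(1-2\varepsilon)^{T-1}\big[(1+\varepsilon)^T-1\big]\Big(1-\min_{\mathbf{x}\in\mathcal{K}}\|\mathbf{x}\|_\infty\Big)F(\mathbf{o})-0.5\varepsilon^2\beta D^2T, \] where $\mathbf{o}\in\arg\max_{\mathbf{x}\in\mathcal{K}}F(\mathbf{x})$. In particular, when $T=\lfloor \ln 2/\varepsilon\rfloor$, \[ F(\mathbf{w})\geq\Big(\tfrac14-3\varepsilon\Big)\Big(1-\min_{\mathbf{x}\in\mathcal{K}}\|\mathbf{x}\|_\infty\Big)F(\mathbf{o})-0.5\varepsilon\beta D^2. \]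
   Context: A function $F\colon[0,1]^n\to\mathbb{R}$ is DR-submodular if for all $\mathbf{a}\leq\mathbf{b}$ (coordinate-wise) in $[0,1]^n$, every $k>0$ and coordinate $i$ with $\mathbf{b}+k\mathbf{e}_i\in[0,1]^n$, we have $F(\mathbf{a}+k\mathbf{e}_i)-F(\mathbf{a})\geq F(\mathbf{b}+k\mathbf{e}_i)-F(\mathbf{b})$. $F$ is $\beta$-smooth if it is continuously differentiable and $\|\nabla F(\mathbf{x})-\nabla F(\mathbf{y})\|_2\leq\beta\|\mathbf{x}-\mathbf{y}\|_2$ for all $\mathbf{x},\mathbf{y}\in[0,1]^n$. Algorithm NMFW$(T,\varepsilon)$: set $\mathbf{y}^{(0)}\in\arg\min_{\mathbf{x}\in\mathcal{K}}\|\mathbf{x}\|_\infty$; for $i=1,\dots,T$, let $\mathbf{s}^{(i)}\in\arg\max_{\mathbf{x}\in\mathcal{K}}\langle\nabla F(\mathbf{y}^{(i-1)}),\mathbf{x}\rangle$ and $\mathbf{y}^{(i)}=(1-\varepsilon)\mathbf{y}^{(i-1)}+\varepsilon\mathbf{s}^{(i)}$; return a vector maximizing $F$ among $\mathbf{y}^{(0)},\dots,\mathbf{y}^{(T)}$.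
   Formalization: The first inequality is proved for ε ≤ 1/2 only; for larger ε it can fail (K={0}, F=1, T=3, ε=0.9 would require 1 ≥ 3.7). Membership of w in K and the final bound for T=⌊ln 2/ε⌋ are proved for all ε in (0,1). *)

theory Defs
  imports "HOL-Analysis.Analysis"
begin

definition unit_cube :: "(real ^ 'n) set" where
  "unit_cube = cbox 0 1"

text \<open>The objective is only given on the closed cube, so derivatives are taken within the cube
  (one-sided at the boundary); values of \<open>F\<close> outside the cube are irrelevant. Within the cube the
  derivative is unique wherever it exists.\<close>

definition cube_gradient :: "(real ^ 'n \<Rightarrow> real) \<Rightarrow> real ^ 'n \<Rightarrow> real ^ 'n" where
  "cube_gradient F x = (\<chi> i. frechet_derivative F (at x within unit_cube) (axis i 1))"

definition DR_submodular :: "(real ^ 'n \<Rightarrow> real) \<Rightarrow> bool" where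
  "DR_submodular F \<longleftrightarrow>
     (\<forall>a\<in>unit_cube. \<forall>b\<in>unit_cube. \<forall>k>0. \<forall>i.
        a \<le> b \<longrightarrow> b + k *\<^sub>R axis i 1 \<in> unit_cube \<longrightarrow>
        F (a + k *\<^sub>R axis i 1) - F a \<ge> F (b + k *\<^sub>R axis i 1) - F b)"

definition smooth_on_cube :: "real \<Rightarrow> (real ^ 'n \<Rightarrow> real) \<Rightarrow> bool" where
  "smooth_on_cube \<beta> F \<longleftrightarrow>
     F differentiable_on unit_cube \<and>
     continuous_on unit_cube (cube_gradient F) \<and>
     (\<forall>x\<in>unit_cube. \<forall>y\<in>unit_cube.
        norm (cube_gradient F x - cube_gradient F y) \<le> \<beta> * norm (x - y))"

text \<open>The algorithm is nondeterministic in its choice of minimizers and maximizers, so it is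
  described by the relation between the input and each vector it may return. Here \<open>y i\<close> and \<open>s i\<close>
  are the iterates; the values \<open>s 0\<close>, and \<open>y i\<close>, \<open>s i\<close> for \<open>i > T\<close>, play no role.\<close>

definition NMFW_output ::
  "(real ^ 'n) set \<Rightarrow> (real ^ 'n \<Rightarrow> real) \<Rightarrow> nat \<Rightarrow> real \<Rightarrow> real ^ 'n \<Rightarrow> bool" where
  "NMFW_output K F T \<epsilon> w \<longleftrightarrow>
     (\<exists>y s.
        is_arg_min infnorm (\<lambda>x. x \<in> K) (y 0) \<and>
        (\<forall>i\<in>{1..T}.
           is_arg_max (\<lambda>x. cube_gradient F (y (i - 1)) \<bullet> x) (\<lambda>x. x \<in> K) (s i) \<and>
           y i = (1 - \<epsilon>) *\<^sub>R y (i - 1) + \<epsilon> *\<^sub>R s i) \<and>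
        is_arg_max F (\<lambda>x. x \<in> y ` {0..T}) w)"

end

theory Submission
  imports Defs
begin

text \<open>DR-submodularity bounds \<open>F\<close> from above by its linearisation along every direction of constant
  sign. Splitting \<open>o - y = (o \<squnion> y - y) - (y - o \<sqinter> y)\<close> gives
  \<open>\<nabla>F(y) \<bullet> (o - y) \<ge> F(o \<squnion> y) + F(o \<sqinter> y) - 2 F(y)\<close>, and the same bound along the segment from \<open>o\<close>
  through \<open>o \<squnion> y\<close> gives \<open>F(o \<squnion> y) \<ge> (1 - \<parallel>y\<parallel>) F(o)\<close>. As \<open>1 - \<parallel>y\<^sup>(\<^sup>i\<^sup>)\<parallel>\<close> shrinks at most by the
  factor \<open>1 - \<epsilon>\<close> per step, smoothness yields the recurrence
  \<open>F(y\<^sup>(\<^sup>i\<^sup>)) \<ge> (1 - 2\<epsilon>) F(y\<^sup>(\<^sup>i\<^sup>-\<^sup>1\<^sup>)) + \<epsilon> (1 - \<epsilon>)\<^sup>i\<^sup>-\<^sup>1 (1 - min \<parallel>x\<parallel>) F(o) - \<epsilon>\<^sup>2 \<beta> D\<^sup>2 / 2\<close>.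
  It is solved using \<open>1 - \<epsilon> \<ge> (1 - 2\<epsilon>) (1 + \<epsilon>)\<close>.\<close>

section \<open>Gradient on the cube and restriction to segments\<close>

lemma mem_unit_cube: "x \<in> unit_cube \<longleftrightarrow> (\<forall>i. 0 \<le> x $ i \<and> x $ i \<le> 1)"
  by (simp add: unit_cube_def mem_box_cart)

lemma convex_unit_cube: "convex (unit_cube :: (real ^ 'n) set)"
  by (simp add: unit_cube_def)

lemma cube_gradient_has_derivative:
  fixes F :: "real ^ 'n \<Rightarrow> real"
  assumes "smooth_on_cube \<beta> F" "x \<in> unit_cube"
  shows "(F has_derivative (\<lambda>h. cube_gradient F x \<bullet> h)) (at x within unit_cube)"
proof -
  let ?D = "frechet_derivative F (at x within unit_cube)"
  have d: "(F has_derivative ?D) (at x within unit_cube)"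
    using assms unfolding smooth_on_cube_def differentiable_on_def
    by (auto simp: frechet_derivative_works)
  then have lin: "linear ?D"
    using has_derivative_linear by blast
  have "?D h = cube_gradient F x \<bullet> h" for h
  proof -
    have "?D h = ?D (\<Sum>i\<in>UNIV. h $ i *\<^sub>R axis i 1)"
      using basis_expansion[of h] by (simp add: scalar_mult_eq_scaleR)
    also have "\<dots> = (\<Sum>i\<in>UNIV. h $ i * ?D (axis i 1))"
      by (simp add: linear_sum[OF lin] linear_cmul[OF lin])
    also have "\<dots> = cube_gradient F x \<bullet> h"
      by (simp add: cube_gradient_def inner_vec_def mult.commute)
    finally show ?thesis .
  qed
  then have "?D = (\<lambda>h. cube_gradient F x \<bullet> h)" by blast
  with d show ?thesis by simp
qed

text \<open>Reduces differentiation to one variable. The derivative is taken within the unit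
  interval because \<open>F\<close> is only differentiable within the cube and the segment may end
  on the boundary.\<close>

lemma line_has_derivative:
  fixes F :: "real ^ 'n \<Rightarrow> real"
  assumes F: "smooth_on_cube \<beta> F" and x: "x \<in> unit_cube" "x + v \<in> unit_cube"
    and t: "t \<in> {0..1}"
  shows "((\<lambda>t. F (x + t *\<^sub>R v)) has_derivative (\<lambda>h. h * (cube_gradient F (x + t *\<^sub>R v) \<bullet> v)))
    (at t within {0..1})"
    and "x + t *\<^sub>R v \<in> unit_cube"
proof -
  have mem: "x + s *\<^sub>R v \<in> unit_cube" if "s \<in> {0..1}" for s
    using convexD_alt[OF convex_unit_cube x, of s] that by (simp add: algebra_simps)
  show "x + t *\<^sub>R v \<in> unit_cube" using mem t .
  have "((\<lambda>t. x + t *\<^sub>R v) has_derivative (\<lambda>h. h *\<^sub>R v)) (at t within {0..1})"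
    by (auto intro!: derivative_eq_intros)
  moreover have "(F has_derivative (\<lambda>h. cube_gradient F (x + t *\<^sub>R v) \<bullet> h))
      (at (x + t *\<^sub>R v) within (\<lambda>t. x + t *\<^sub>R v) ` {0..1})"
    using cube_gradient_has_derivative[OF F mem[OF t]] mem
    by (rule_tac has_derivative_subset) auto
  ultimately show "((\<lambda>t. F (x + t *\<^sub>R v)) has_derivative
      (\<lambda>h. h * (cube_gradient F (x + t *\<^sub>R v) \<bullet> v))) (at t within {0..1})"
    using has_derivative_in_compose by fastforce
qed

text \<open>The Lipschitz bound lets the slope at time t fall below the initial slope by at most
  \<beta> t |v|^2, which integrates to \<beta>/2 |v|^2. The mean value theorem takes the place of
  the integral.\<close>

lemma smooth_lower_bound:
  fixes F :: "real ^ 'n \<Rightarrow> real"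
  assumes F: "smooth_on_cube \<beta> F" and x: "x \<in> unit_cube" "x + v \<in> unit_cube"
  shows "F (x + v) \<ge> F x + cube_gradient F x \<bullet> v - \<beta> / 2 * (norm v)\<^sup>2"
proof -
  let ?g = "cube_gradient F"
  \<comment> \<open>\<open>\<psi> 1 - \<psi> 0\<close> is the difference of the two sides of the
    claim. The quadratic term has as its derivative exactly the largest admissible drop of the
    slope.\<close>
  define \<psi> where "\<psi> t = F (x + t *\<^sub>R v) - t * (?g x \<bullet> v) + \<beta> / 2 * t\<^sup>2 * (norm v)\<^sup>2" for t
  define \<psi>' where
    "\<psi>' t h = h * ((?g (x + t *\<^sub>R v) - ?g x) \<bullet> v + \<beta> * t * (norm v)\<^sup>2)" for t h
  have "(\<psi> has_derivative \<psi>' t) (at t within {0..1})" if "t \<in> {0..1}" for t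
    unfolding \<psi>_def \<psi>'_def
    by (rule derivative_eq_intros line_has_derivative(1)[OF F x that] refl)+
       (simp add: fun_eq_iff algebra_simps inner_diff_left)
  then obtain t where t: "t \<in> {0..1}" "\<psi> 1 - \<psi> 0 = \<psi>' t (1 - 0)"
    using mvt_very_simple[of 0 1 \<psi> \<psi>'] by auto
  have "\<bar>(?g (x + t *\<^sub>R v) - ?g x) \<bullet> v\<bar> \<le> norm (?g (x + t *\<^sub>R v) - ?g x) * norm v"
    by (rule Cauchy_Schwarz_ineq2)
  also have "\<dots> \<le> (\<beta> * norm (x + t *\<^sub>R v - x)) * norm v"
    using F line_has_derivative(2)[OF F x t(1)] x(1) unfolding smooth_on_cube_def
    by (intro mult_right_mono norm_ge_zero) blast
  also have "\<dots> = \<beta> * t * (norm v)\<^sup>2"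
    using t by (simp add: power2_eq_square)
  finally have "\<psi>' t 1 \<ge> 0" by (simp add: \<psi>'_def)
  with t(2) show ?thesis by (simp add: \<psi>_def)
qed

section \<open>Increments and linearisation of DR-submodular functions\<close>

text \<open>The definition compares steps along a single coordinate. Here the step \<open>u\<close>
  is assembled one coordinate at a time, \<open>r S\<close> being its part on \<open>S\<close>, and
  the single-coordinate inequalities add up.\<close>

lemma DR_submodular_increment_antimono:
  fixes F :: "real ^ 'n \<Rightarrow> real"
  assumes F: "DR_submodular F" and a: "a \<in> unit_cube" "a \<le> b" and u: "0 \<le> u"
    and b: "b + u \<in> unit_cube"
  shows "F (a + u) - F a \<ge> F (b + u) - F b"
proof -
  define r :: "'n set \<Rightarrow> real ^ 'n" where "r S = (\<chi> i. if i \<in> S then u $ i else 0)" for S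
  have le: "0 \<le> a $ i" "a $ i \<le> b $ i" "0 \<le> u $ i" "b $ i + u $ i \<le> 1" for i
    using a u b by (auto simp: mem_unit_cube less_eq_vec_def)
  have bounds: "0 \<le> r S $ i" "r S $ i \<le> u $ i" for S i
    using le by (auto simp: r_def)
  have "F (a + r S) - F a \<ge> F (b + r S) - F b" if "finite S" for S
    using that
  proof (induction S rule: finite_induct)
    case empty
    have "r {} = 0" by (simp add: r_def vec_eq_iff)
    then show ?case by simp
  next
    case (insert j S)
    have r: "r (insert j S) = r S + u $ j *\<^sub>R axis j 1"
      using insert.hyps by (auto simp: r_def vec_eq_iff axis_def)
    show ?case
    \<comment> \<open>The definition only speaks of steps of positive length.\<close>
    proof (cases "u $ j = 0")
      case True
      then show ?thesis using insert.IH r by simp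
    next
      case False
      have "0 \<le> a $ i + r S $ i \<and> a $ i + r S $ i \<le> 1 \<and> 0 \<le> b $ i + r S $ i \<and> b $ i + r S $ i \<le> 1
          \<and> 0 \<le> b $ i + r (insert j S) $ i \<and> b $ i + r (insert j S) $ i \<le> 1" for i
        using le[of i] bounds[of S i] bounds[of "insert j S" i] by linarith
      then have "a + r S \<in> unit_cube" "b + r S \<in> unit_cube" "b + r (insert j S) \<in> unit_cube"
        by (auto simp: mem_unit_cube)
      moreover have "a + r S \<le> b + r S" "u $ j > 0"
        using a le[of j] False by auto
      ultimately have "F (a + r S + u $ j *\<^sub>R axis j 1) - F (a + r S)
          \<ge> F (b + r S + u $ j *\<^sub>R axis j 1) - F (b + r S)"
        using F unfolding DR_submodular_def r add.assoc[symmetric] by blast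
      then show ?thesis using insert.IH by (simp add: r add.assoc)
    qed
  qed
  from this[of UNIV] show ?thesis by (simp add: r_def)
qed

text \<open>Cut the segment into N equal pieces. Diminishing returns make each increment at most the
  first one, so the total is at most N times the first, and this tends to the directional derivative
  as N grows.\<close>

lemma DR_submodular_linearization_upper_bound:
  fixes F :: "real ^ 'n \<Rightarrow> real"
  assumes S: "smooth_on_cube \<beta> F" and DR: "DR_submodular F"
    and x: "x \<in> unit_cube" "x + u \<in> unit_cube" and u: "0 \<le> u \<or> u \<le> 0"
  shows "F (x + u) - F x \<le> cube_gradient F x \<bullet> u"
proof -
  define p where "p t = F (x + t *\<^sub>R u)" for t
  have "(p has_field_derivative (cube_gradient F x \<bullet> u)) (at 0 within {0..1})"
    using line_has_derivative(1)[OF S x, of 0]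
    by (simp add: p_def[abs_def] has_field_derivative_def mult_commute_abs)
  then have lim: "((\<lambda>t. (p t - p 0) / t) \<longlongrightarrow> cube_gradient F x \<bullet> u) (at 0 within {0..1})"
    by (simp add: has_field_derivative_iff)
  have "filterlim (\<lambda>n. 1 / real (Suc n)) (at 0 within {0..1}) sequentially"
    unfolding filterlim_at using LIMSEQ_inverse_real_of_nat by (auto simp: field_simps)
  from filterlim_compose[OF lim this]
  have lim': "(\<lambda>n. real (Suc n) * (p (1 / real (Suc n)) - p 0)) \<longlonglongrightarrow> cube_gradient F x \<bullet> u"
    by (simp add: mult.commute)
  have "p 1 - p 0 \<le> real (Suc n) * (p (1 / real (Suc n)) - p 0)" for n
  proof -
    let ?N = "real (Suc n)"
    have step: "p (real (Suc k) / ?N) - p (real k / ?N) \<le> p (1 / ?N) - p 0" if k: "k < Suc n" for k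
    proof -
      have mem: "x + (real j / ?N) *\<^sub>R u \<in> unit_cube" if "j \<le> Suc n" for j
        using line_has_derivative(2)[OF S x, of "real j / ?N"] that by simp
      let ?d = "(1 / ?N) *\<^sub>R u" and ?c = "(real k / ?N) *\<^sub>R u"
      have Suc_k: "x + (real (Suc k) / ?N) *\<^sub>R u = x + ?c + ?d"
        by (simp add: add_divide_distrib scaleR_add_left)
      have mem_cd: "x + ?c + ?d \<in> unit_cube"
        using mem[of "Suc k"] k unfolding Suc_k by simp
      have "F (x + ?c + ?d) - F (x + ?c) \<le> F (x + ?d) - F x"
        using u
      proof
        assume "0 \<le> u"
        then have "0 \<le> ?c" "0 \<le> ?d"
          by (auto simp: less_eq_vec_def)
        then show ?thesis
          using x mem_cd by (intro DR_submodular_increment_antimono[OF DR]) auto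
      next
        \<comment> \<open>Traversed backwards, each piece is a nonnegative step \<open>- ?d\<close>,
          once from \<open>x + ?c + ?d\<close> and once from the larger point \<open>x + ?d\<close>.
          Negating the comparison of these increments gives the claim.\<close>
        assume "u \<le> 0"
        then have "?c \<le> 0" "0 \<le> - ?d"
          by (auto simp: less_eq_vec_def divide_nonpos_pos mult_nonneg_nonpos)
        moreover from \<open>?c \<le> 0\<close> have "x + ?c + ?d \<le> x + ?d" by simp
        ultimately show ?thesis
          using x mem_cd DR_submodular_increment_antimono[OF DR, of "x + ?c + ?d" "x + ?d" "- ?d"]
          by simp
      qed
      then show ?thesis
        unfolding p_def Suc_k by simp
    qed
    have "p 1 - p 0 = (\<Sum>k<Suc n. p (real (Suc k) / ?N) - p (real k / ?N))"
      by (subst sum_lessThan_telescope) simp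
    also have "\<dots> \<le> (\<Sum>k<Suc n. p (1 / ?N) - p 0)"
      by (intro sum_mono step) auto
    finally show ?thesis by simp
  qed
  then have "p 1 - p 0 \<le> cube_gradient F x \<bullet> u"
    by (intro tendsto_lowerbound[OF lim']) auto
  then show ?thesis by (simp add: p_def)
qed

lemma gradient_lower_bound:
  fixes F :: "real ^ 'n \<Rightarrow> real"
  assumes S: "smooth_on_cube \<beta> F" and DR: "DR_submodular F"
    and x: "x \<in> unit_cube" and z: "z \<in> unit_cube"
  shows "cube_gradient F x \<bullet> (z - x)
    \<ge> F (\<chi> i. max (x $ i) (z $ i)) + F (\<chi> i. min (x $ i) (z $ i)) - 2 * F x"
proof -
  define u :: "real ^ 'n" where "u = (\<chi> i. max (x $ i) (z $ i)) - x"
  define v :: "real ^ 'n" where "v = (\<chi> i. min (x $ i) (z $ i)) - x"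
  have "x + u \<in> unit_cube" "0 \<le> u" "x + v \<in> unit_cube" "v \<le> 0"
    using x z by (auto simp: u_def v_def mem_unit_cube less_eq_vec_def max_def min_def)
  then have "F (x + u) - F x \<le> cube_gradient F x \<bullet> u" "F (x + v) - F x \<le> cube_gradient F x \<bullet> v"
    using DR_submodular_linearization_upper_bound[OF S DR x] by blast+
  moreover have "z - x = u + v"
    by (auto simp: u_def v_def vec_eq_iff max_def min_def)
  moreover have "x + u = (\<chi> i. max (x $ i) (z $ i))" "x + v = (\<chi> i. min (x $ i) (z $ i))"
    by (simp_all add: u_def v_def)
  ultimately show ?thesis
    by (simp add: inner_add_right)
qed

text \<open>The join lies on a segment in a nonnegative direction from \<open>z\<close> to a point
  \<open>z + v\<close> of the cube, at fraction \<theta>. Concavity along that segment gives weight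
  1 - \<theta> to \<open>F z\<close>, and the other endpoint contributes a nonnegative
  amount.\<close>

lemma F_max_lower_bound:
  fixes F :: "real ^ 'n \<Rightarrow> real"
  assumes S: "smooth_on_cube \<beta> F" and DR: "DR_submodular F"
    and nonneg: "\<And>x. x \<in> unit_cube \<Longrightarrow> F x \<ge> 0"
    and x: "x \<in> unit_cube" and z: "z \<in> unit_cube"
    and \<theta>: "\<And>i. x $ i \<le> \<theta>" "\<theta> \<le> 1"
  shows "F (\<chi> i. max (x $ i) (z $ i)) \<ge> (1 - \<theta>) * F z"
proof -
  define m :: "real ^ 'n" where "m = (\<chi> i. max (x $ i) (z $ i))"
  have x0: "0 \<le> x $ i" and z01: "0 \<le> z $ i" "z $ i \<le> 1" for i
    using x z by (auto simp: mem_unit_cube)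
  have m: "m \<in> unit_cube"
    using x z by (auto simp: m_def mem_unit_cube max_def)
  have "0 \<le> \<theta>" using x0 \<theta>(1) order_trans by blast
  show ?thesis
  proof (cases "\<theta> = 0")
    case True
    then have "x $ i = 0" for i using x0 \<theta>(1) by (simp add: order_antisym)
    then have "m = z" using z01 by (simp add: m_def vec_eq_iff)
    then show ?thesis using True by (simp add: m_def)
  next
    case False
    with \<open>0 \<le> \<theta>\<close> have pos: "\<theta> > 0" by simp
    define v where "v = (1 / \<theta>) *\<^sub>R (m - z)"
    have v0: "0 \<le> v $ i" for i
      using pos by (simp add: v_def m_def)
    have v1: "z $ i + v $ i \<le> 1" for i
    proof (cases "x $ i \<le> z $ i")
      case True
      then show ?thesis using z01 by (simp add: v_def m_def)
    next
      case False
      \<comment> \<open>This is where \<theta> \<le> 1 keeps the prolonged segment inside the cube: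
        \<open>x $ i\<close> is at most \<theta>, and \<open>z $ i\<close> is at least its multiple
        by \<theta>.\<close>
      have "x $ i - z $ i \<le> \<theta> - \<theta> * z $ i"
        using \<theta>(1)[of i] mult_right_mono[OF \<theta>(2) z01(1)[of i]] by simp
      then have "(x $ i - z $ i) / \<theta> \<le> 1 - z $ i"
        using pos by (simp add: field_simps)
      then show ?thesis using False by (simp add: v_def m_def)
    qed
    have zv: "z + v \<in> unit_cube"
      using z01 v0 v1 by (auto simp: mem_unit_cube)
    have mv: "m = z + \<theta> *\<^sub>R v" using pos by (simp add: v_def)
    \<comment> \<open>Linearise at \<open>m\<close> towards both endpoints. With weights \<theta>
      and 1 - \<theta> the two gradient terms cancel.\<close>
    have "F (m + (1 - \<theta>) *\<^sub>R v) - F m \<le> cube_gradient F m \<bullet> ((1 - \<theta>) *\<^sub>R v)"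
      using zv v0 \<theta>(2) by (intro DR_submodular_linearization_upper_bound[OF S DR m])
        (auto simp: mv less_eq_vec_def algebra_simps mult_left_le_one_le pos less_imp_le)
    moreover have "F (m + (- \<theta>) *\<^sub>R v) - F m \<le> cube_gradient F m \<bullet> ((- \<theta>) *\<^sub>R v)"
      using z v0 pos by (intro DR_submodular_linearization_upper_bound[OF S DR m])
        (auto simp: mv less_eq_vec_def)
    moreover have "m + (1 - \<theta>) *\<^sub>R v = z + v" "m + (- \<theta>) *\<^sub>R v = z"
      by (simp_all add: mv algebra_simps)
    ultimately have
      1: "F (z + v) - F m \<le> (1 - \<theta>) * (cube_gradient F m \<bullet> v)" and
      2: "F z - F m \<le> - (\<theta> * (cube_gradient F m \<bullet> v))"
      by simp_all
    have "\<theta> * (F (z + v) - F m) + (1 - \<theta>) * (F z - F m) \<le> 0"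
      using mult_left_mono[OF 1 \<open>0 \<le> \<theta>\<close>] mult_left_mono[OF 2, of "1 - \<theta>"] \<theta>(2)
      by (simp add: algebra_simps)
    moreover have "0 \<le> \<theta> * F (z + v)"
      using nonneg[OF zv] pos by simp
    ultimately have "(1 - \<theta>) * F z \<le> F m" by (simp add: algebra_simps)
    then show ?thesis by (simp add: m_def)
  qed
qed

section \<open>Solving the recurrence and estimating its constant\<close>

text \<open>Induction on k. The new gain dominates \<open>\<epsilon> * (1 - 2 * \<epsilon>) ^ k * (1
  + \<epsilon>) ^ k * M\<close>, just what raises the power of 1 + \<epsilon> by one. Old errors are
  multiplied by a factor in [0, 1], so each step adds at most \<open>C\<close>.\<close>

lemma recurrence_lower_bound:
  fixes f :: "nat \<Rightarrow> real"
  assumes \<epsilon>: "0 < \<epsilon>" "\<epsilon> \<le> 1 / 2" and M: "0 \<le> M" and C: "0 \<le> C" and f0: "0 \<le> f 0"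
    and step: "\<And>k. k < T \<Longrightarrow> f (Suc k) \<ge> (1 - 2 * \<epsilon>) * f k + \<epsilon> * (1 - \<epsilon>) ^ k * M - C"
  shows "k \<le> T \<Longrightarrow> f k \<ge> (1 - 2 * \<epsilon>) ^ (k - 1) * ((1 + \<epsilon>) ^ k - 1) * M - C * real k"
proof (induction k)
  case 0
  then show ?case using f0 by simp
next
  case (Suc k)
  let ?c = "1 - 2 * \<epsilon>"
  have c: "0 \<le> ?c" "?c \<le> 1" using \<epsilon> by auto
  have "?c * (1 + \<epsilon>) \<le> 1 - \<epsilon>" by (simp add: algebra_simps)
  then have "(?c * (1 + \<epsilon>)) ^ k \<le> (1 - \<epsilon>) ^ k"
    using c \<epsilon> by (intro power_mono) auto
  then have "\<epsilon> * (?c ^ k * (1 + \<epsilon>) ^ k) * M \<le> \<epsilon> * (1 - \<epsilon>) ^ k * M"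
    using \<epsilon> M by (intro mult_left_mono mult_right_mono) (auto simp: power_mult_distrib)
  moreover have "?c * (?c ^ (k - 1) * ((1 + \<epsilon>) ^ k - 1) * M - C * real k) \<le> ?c * f k"
    using Suc c by (intro mult_left_mono) auto
  \<comment> \<open>At k = 0 the exponent k - 1 is truncated to 0, but the factor
    \<open>(1 + \<epsilon>) ^ k - 1\<close> vanishes.\<close>
  moreover have "?c * (?c ^ (k - 1) * ((1 + \<epsilon>) ^ k - 1) * M) = ?c ^ k * ((1 + \<epsilon>) ^ k - 1) * M"
    by (cases k) auto
  moreover have "?c * (C * real k) \<le> C * real k"
    using c C by (intro mult_left_le_one_le) auto
  moreover have "?c ^ k * ((1 + \<epsilon>) ^ Suc k - 1) * M
      = ?c ^ k * ((1 + \<epsilon>) ^ k - 1) * M + \<epsilon> * (?c ^ k * (1 + \<epsilon>) ^ k) * M"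
    by (simp add: algebra_simps)
  moreover have "f (Suc k) \<ge> ?c * f k + \<epsilon> * (1 - \<epsilon>) ^ k * M - C"
    using step Suc.prems by simp
  moreover have "C * real (Suc k) = C * real k + C"
    by (simp add: distrib_left)
  ultimately show ?case
    unfolding diff_Suc_1 right_diff_distrib[of ?c _ "C * real k"] by linarith
qed

text \<open>For T near ln 2 / \<epsilon> the two factors approach 1/4 and 1. Logarithm estimates
  bound them below by (1 - 6\<epsilon>)/4 and 1 - 4\<epsilon>, whose product is 1/4 - 5\<epsilon>/2
  + 6\<epsilon>^2.\<close>

lemma quarter_minus_three_epsilon_le:
  fixes \<epsilon> :: real
  assumes \<epsilon>: "0 < \<epsilon>" "\<epsilon> < 1 / 12" and T: "int T = \<lfloor>ln 2 / \<epsilon>\<rfloor>"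
  shows "1 / 4 - 3 * \<epsilon> \<le> (1 - 2 * \<epsilon>) ^ (T - 1) * ((1 + \<epsilon>) ^ T - 1)"
proof -
  have ln2: "1 / 2 < ln (2 :: real)" "ln (2 :: real) < 1"
    using ln_2_less_1 ln2_ge_two_thirds by auto
  have T_le: "real T \<le> ln 2 / \<epsilon>" and T_gt: "ln 2 / \<epsilon> - 1 < real T"
    using T by linarith+
  \<comment> \<open>Rules out T = 0, so that T - 1 is a genuine subtraction.\<close>
  have "ln 2 / \<epsilon> \<ge> 2" using \<epsilon> ln2 by (simp add: field_simps)
  with T_gt have T1: "T \<ge> 1" by linarith
  have "ln (1 - 2 * \<epsilon>) \<ge> - (2 * \<epsilon>) - 2 * (2 * \<epsilon>)\<^sup>2"
    using \<epsilon> by (intro ln_one_minus_pos_lower_bound) auto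
  then have "real (T - 1) * ln (1 - 2 * \<epsilon>) \<ge> - (real (T - 1) * (2 * \<epsilon> + 8 * \<epsilon>\<^sup>2))"
    unfolding mult_minus_right[symmetric]
    by (intro mult_left_mono) (auto simp: power2_eq_square)
  moreover have "real (T - 1) * (2 * \<epsilon> + 8 * \<epsilon>\<^sup>2) \<le> (ln 2 / \<epsilon> - 1) * (2 * \<epsilon> + 8 * \<epsilon>\<^sup>2)"
    using T_le T1 \<epsilon> by (intro mult_right_mono) auto
  \<comment> \<open>The term -2\<epsilon> is the gain from the exponent T - 1 instead of T. With ln
    2 < 1 it reduces the error from 8\<epsilon> to 6\<epsilon>.\<close>
  moreover have "(ln 2 / \<epsilon> - 1) * (2 * \<epsilon> + 8 * \<epsilon>\<^sup>2) = 2 * ln 2 + 8 * (ln 2 * \<epsilon>) - 2 * \<epsilon> - 8 * \<epsilon>\<^sup>2"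
    using \<epsilon> by (simp add: field_simps power2_eq_square)
  moreover have "ln 2 * \<epsilon> \<le> \<epsilon>" using \<epsilon> ln2 by simp
  ultimately have "real (T - 1) * ln (1 - 2 * \<epsilon>) \<ge> - 2 * ln 2 - 6 * \<epsilon>"
    using zero_le_power2[of \<epsilon>] by linarith
  then have *: "exp (- 2 * ln 2 - 6 * \<epsilon>) \<le> exp (real (T - 1) * ln (1 - 2 * \<epsilon>))"
    by simp
  have exp4: "exp (2 * ln 2) = (4 :: real)"
    using exp_of_nat_mult[of 2 "ln 2 :: real"] by simp
  have "(1 - 6 * \<epsilon>) / 4 \<le> exp (- 6 * \<epsilon>) / 4"
    using exp_ge_add_one_self[of "- 6 * \<epsilon>"] by simp
  also have "\<dots> = exp (- 2 * ln 2 - 6 * \<epsilon>)"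
    by (simp add: exp_diff exp_minus exp4 field_simps)
  also note *
  also have "exp (real (T - 1) * ln (1 - 2 * \<epsilon>)) = (1 - 2 * \<epsilon>) ^ (T - 1)"
    using \<epsilon> by (simp add: exp_of_nat_mult)
  finally have A: "(1 - 2 * \<epsilon>) ^ (T - 1) \<ge> (1 - 6 * \<epsilon>) / 4" .
  have "ln (1 + \<epsilon>) \<ge> \<epsilon> - \<epsilon>\<^sup>2"
    using \<epsilon> by (intro ln_one_plus_pos_lower_bound) auto
  then have "real T * ln (1 + \<epsilon>) \<ge> real T * (\<epsilon> - \<epsilon>\<^sup>2)"
    by (intro mult_left_mono) auto
  moreover have "real T * (\<epsilon> - \<epsilon>\<^sup>2) \<ge> (ln 2 / \<epsilon> - 1) * (\<epsilon> - \<epsilon>\<^sup>2)"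
    using T_gt \<epsilon> by (intro mult_right_mono) (auto simp: power2_eq_square)
  moreover have "(ln 2 / \<epsilon> - 1) * (\<epsilon> - \<epsilon>\<^sup>2) = ln 2 - ln 2 * \<epsilon> - \<epsilon> + \<epsilon>\<^sup>2"
    using \<epsilon> by (simp add: field_simps power2_eq_square)
  ultimately have "real T * ln (1 + \<epsilon>) \<ge> ln 2 - 2 * \<epsilon>"
    using \<open>ln 2 * \<epsilon> \<le> \<epsilon>\<close> zero_le_power2[of \<epsilon>] by linarith
  then have "exp (real T * ln (1 + \<epsilon>)) \<ge> exp (ln 2 - 2 * \<epsilon>)"
    by simp
  moreover have "exp (real T * ln (1 + \<epsilon>)) = (1 + \<epsilon>) ^ T"
    using \<epsilon> by (simp add: exp_of_nat_mult)
  moreover have "exp (ln 2 - 2 * \<epsilon>) = 2 * exp (- 2 * \<epsilon>)"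
    by (simp add: exp_diff exp_minus field_simps)
  moreover have "exp (- 2 * \<epsilon>) \<ge> 1 - 2 * \<epsilon>"
    using exp_ge_add_one_self[of "- 2 * \<epsilon>"] by simp
  ultimately have B: "(1 + \<epsilon>) ^ T - 1 \<ge> 1 - 4 * \<epsilon>"
    by simp
  have "1 / 4 - 3 * \<epsilon> \<le> (1 - 6 * \<epsilon>) / 4 * (1 - 4 * \<epsilon>)"
    using \<epsilon> by (simp add: field_simps)
  also have "\<dots> \<le> (1 - 2 * \<epsilon>) ^ (T - 1) * ((1 + \<epsilon>) ^ T - 1)"
    using A B \<epsilon> by (intro mult_mono) auto
  finally show ?thesis .
qed

section \<open>Guarantee for the iterates of the algorithm\<close>

text \<open>The first bound is restricted to \<epsilon> \<le> 1/2, where 1 - 2\<epsilon> is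
  nonnegative. For \<epsilon> near 1 and T = 3 its leading coefficient is near 7, and a positive
  constant \<open>F\<close> with small \<beta> and 0 in \<open>K\<close> would violate it. The
  integer power keeps the exponent -1 at T = 0.\<close>

theorem theorem3p1:
  fixes K :: "(real ^ 'n) set" and F :: "real ^ 'n \<Rightarrow> real"
    and D \<beta> \<epsilon> :: real and T :: nat and w opt :: "real ^ 'n"
  assumes "K \<subseteq> unit_cube" and "convex K" and "D = diameter K"
    and "\<beta> > 0"
    and "\<And>x. x \<in> unit_cube \<Longrightarrow> F x \<ge> 0"
    and "smooth_on_cube \<beta> F"
    and "DR_submodular F"
    and "0 < \<epsilon>" and "\<epsilon> < 1"
    and "NMFW_output K F T \<epsilon> w"
    and "is_arg_max F (\<lambda>x. x \<in> K) opt"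
  shows "w \<in> K
    \<and> (\<epsilon> \<le> 1 / 2 \<longrightarrow>
        F w \<ge> (1 - 2 * \<epsilon>) powi (int T - 1) * ((1 + \<epsilon>) ^ T - 1)
                * (1 - (INF x\<in>K. infnorm x)) * F opt
              - 0.5 * \<epsilon>\<^sup>2 * \<beta> * D\<^sup>2 * real T)
    \<and> (int T = \<lfloor>ln 2 / \<epsilon>\<rfloor> \<longrightarrow>
        F w \<ge> (1 / 4 - 3 * \<epsilon>) * (1 - (INF x\<in>K. infnorm x)) * F opt
              - 0.5 * \<epsilon> * \<beta> * D\<^sup>2)"
proof -
  note cube = subsetD[OF \<open>K \<subseteq> unit_cube\<close>]
  obtain y s where y0: "is_arg_min infnorm (\<lambda>x. x \<in> K) (y 0)"
    and s: "\<And>i. i \<in> {1..T} \<Longrightarrow> is_arg_max (\<lambda>x. cube_gradient F (y (i - 1)) \<bullet> x) (\<lambda>x. x \<in> K) (s i)"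
    and ys: "\<And>i. i \<in> {1..T} \<Longrightarrow> y i = (1 - \<epsilon>) *\<^sub>R y (i - 1) + \<epsilon> *\<^sub>R s i"
    and w: "is_arg_max F (\<lambda>x. x \<in> y ` {0..T}) w"
    using \<open>NMFW_output K F T \<epsilon> w\<close> unfolding NMFW_output_def by blast
  have sK: "s (Suc k) \<in> K"
    and s_max: "\<And>x. x \<in> K \<Longrightarrow> cube_gradient F (y k) \<bullet> x \<le> cube_gradient F (y k) \<bullet> s (Suc k)"
    and y_Suc: "y (Suc k) = (1 - \<epsilon>) *\<^sub>R y k + \<epsilon> *\<^sub>R s (Suc k)" if "k < T" for k
    using s[of "Suc k"] ys[of "Suc k"] that by (auto simp: is_arg_max_linorder)
  have yK: "y k \<in> K" if "k \<le> T" for k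
    using that
  proof (induction k)
    case 0
    then show ?case using y0 by (simp add: is_arg_min_def)
  next
    case (Suc k)
    then show ?case
      using y_Suc[of k] convexD[OF \<open>convex K\<close>, of "y k" "s (Suc k)" "1 - \<epsilon>" \<epsilon>] sK[of k]
        \<open>0 < \<epsilon>\<close> \<open>\<epsilon> < 1\<close> by simp
  qed
  have wK: "w \<in> K" and F_w: "\<And>k. k \<le> T \<Longrightarrow> F (y k) \<le> F w"
    using w yK by (auto simp: is_arg_max_linorder)
  have optK: "opt \<in> K" using \<open>is_arg_max F (\<lambda>x. x \<in> K) opt\<close> by (simp add: is_arg_max_def)

  define m where "m = infnorm (y 0)"
  have m: "(INF x\<in>K. infnorm x) = m"
    unfolding m_def using y0 by (intro cInf_eq_minimum) (auto simp: is_arg_min_linorder)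
  have y0_le: "y 0 $ i \<le> m" for i
    using component_le_infnorm_cart[of "y 0" i] by (simp add: m_def)
  have m1: "m \<le> 1"
    using cube[OF yK[of 0]] unfolding m_def infnorm_cart
    by (intro cSup_least) (auto simp: mem_unit_cube)
  \<comment> \<open>A coordinatewise bound, as \<open>F_max_lower_bound\<close> takes it; the
    induction estimates the coordinates of \<open>s\<close> by 1.\<close>
  have \<theta>: "y k $ i \<le> 1 - (1 - \<epsilon>) ^ k * (1 - m)" if "k \<le> T" for k i
    using that
  proof (induction k)
    case 0
    then show ?case using y0_le by simp
  next
    case (Suc k)
    have "s (Suc k) $ i \<le> 1" using cube[OF sK[of k]] Suc.prems by (simp add: mem_unit_cube)
    then have "\<epsilon> * s (Suc k) $ i \<le> \<epsilon>" using \<open>0 < \<epsilon>\<close> by simp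
    moreover have "(1 - \<epsilon>) * y k $ i \<le> (1 - \<epsilon>) * (1 - (1 - \<epsilon>) ^ k * (1 - m))"
      using Suc \<open>\<epsilon> < 1\<close> by (intro mult_left_mono) auto
    ultimately show ?case using Suc.prems by (simp add: y_Suc right_diff_distrib)
  qed
  define M where "M = (1 - m) * F opt"
  have M0: "0 \<le> M" using m1 assms(5)[OF cube[OF optK]] by (simp add: M_def)
  define C where "C = 0.5 * \<epsilon>\<^sup>2 * \<beta> * D\<^sup>2"
  have C0: "0 \<le> C" using \<open>\<beta> > 0\<close> by (simp add: C_def)
  have "bounded K"
    using \<open>K \<subseteq> unit_cube\<close> bounded_cbox bounded_subset unfolding unit_cube_def by blast
  have step: "F (y (Suc k)) \<ge> (1 - 2 * \<epsilon>) * F (y k) + \<epsilon> * (1 - \<epsilon>) ^ k * M - C" if k: "k < T" for k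
  proof -
    let ?g = "cube_gradient F (y k)"
    have yk: "y k \<in> K" and yk': "y (Suc k) \<in> K" using yK k by auto
    define v where "v = s (Suc k) - y k"
    have ysv: "y (Suc k) = y k + \<epsilon> *\<^sub>R v"
      using y_Suc[OF k] by (simp add: v_def algebra_simps)
    have "norm v \<le> D"
      using diameter_bounded_bound[OF \<open>bounded K\<close> sK[OF k] yk] \<open>D = diameter K\<close>
      by (simp add: v_def dist_norm)
    then have "(norm (\<epsilon> *\<^sub>R v))\<^sup>2 \<le> \<epsilon>\<^sup>2 * D\<^sup>2"
      by (simp add: power_mult_distrib mult_left_mono power_mono)
    then have "\<beta> / 2 * (norm (\<epsilon> *\<^sub>R v))\<^sup>2 \<le> \<beta> / 2 * (\<epsilon>\<^sup>2 * D\<^sup>2)"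
      using \<open>\<beta> > 0\<close> by (intro mult_left_mono) auto
    then have "\<beta> / 2 * (norm (\<epsilon> *\<^sub>R v))\<^sup>2 \<le> C" by (simp add: C_def mult_ac)
    then have 1: "F (y (Suc k)) \<ge> F (y k) + \<epsilon> * (?g \<bullet> v) - C"
      using smooth_lower_bound[OF \<open>smooth_on_cube \<beta> F\<close>, of "y k" "\<epsilon> *\<^sub>R v"] cube[OF yk] cube[OF yk']
      by (simp add: ysv)
    \<comment> \<open>\<open>opt\<close> competes in the linear problem solved by
      \<open>s (Suc k)\<close>, so its direction can stand in for \<open>v\<close>.\<close>
    have "?g \<bullet> v \<ge> ?g \<bullet> (opt - y k)"
      using s_max[OF k optK] by (simp add: v_def inner_diff_right)
    moreover have "?g \<bullet> (opt - y k) \<ge> F (\<chi> i. max (y k $ i) (opt $ i))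
        + F (\<chi> i. min (y k $ i) (opt $ i)) - 2 * F (y k)"
      using gradient_lower_bound[OF assms(6,7)] cube yk optK by blast
    moreover have "F (\<chi> i. max (y k $ i) (opt $ i))
        \<ge> (1 - (1 - (1 - \<epsilon>) ^ k * (1 - m))) * F opt"
      using \<theta>[of k] k m1 \<open>\<epsilon> < 1\<close> cube yk optK
      by (intro F_max_lower_bound[OF assms(6,7,5)]) auto
    moreover have "F (\<chi> i. min (y k $ i) (opt $ i)) \<ge> 0"
      using cube[OF yk] cube[OF optK] by (intro assms(5)) (auto simp: mem_unit_cube min_def)
    ultimately have "?g \<bullet> v \<ge> (1 - \<epsilon>) ^ k * M - 2 * F (y k)"
      by (simp add: M_def)
    from mult_left_mono[OF this, of \<epsilon>] 1 \<open>0 < \<epsilon>\<close> show ?thesis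
      by (simp add: algebra_simps)
  qed
  have main: "F w \<ge> (1 - 2 * \<epsilon>) ^ (T - 1) * ((1 + \<epsilon>) ^ T - 1) * M - C * real T" if "\<epsilon> \<le> 1 / 2"
    using recurrence_lower_bound[of \<epsilon> M C "\<lambda>k. F (y k)" T T] step M0 C0 that \<open>0 < \<epsilon>\<close>
      assms(5)[OF cube[OF yK[of 0]]] F_w[of T] by auto
  have first: "F w \<ge> (1 - 2 * \<epsilon>) powi (int T - 1) * ((1 + \<epsilon>) ^ T - 1) * (1 - m) * F opt
      - 0.5 * \<epsilon>\<^sup>2 * \<beta> * D\<^sup>2 * real T" if "\<epsilon> \<le> 1 / 2"
  proof (cases T)
    \<comment> \<open>The factor \<open>(1 + \<epsilon>) ^ 0 - 1\<close> is zero whatever the power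
      with exponent -1 is, leaving \<open>F w \<ge> 0\<close>.\<close>
    case 0
    then show ?thesis using assms(5)[OF cube[OF wK]] by simp
  next
    case (Suc n)
    then show ?thesis using main[OF that] by (simp add: M_def C_def mult_ac)
  qed
  have second: "F w \<ge> (1 / 4 - 3 * \<epsilon>) * (1 - m) * F opt - 0.5 * \<epsilon> * \<beta> * D\<^sup>2"
    if T: "int T = \<lfloor>ln 2 / \<epsilon>\<rfloor>"
  \<comment> \<open>From 1/12 on the coefficient 1/4 - 3\<epsilon> is nonpositive and nonnegativity
    of \<open>F\<close> suffices. Below it, \<epsilon> T \<le> ln 2 < 1 turns the factor
    \<epsilon>^2 T of the error into \<epsilon>.\<close>
  proof (cases "\<epsilon> < 1 / 12")
    case True
    have "real T \<le> ln 2 / \<epsilon>" using T by linarith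
    then have "\<epsilon> * real T \<le> ln 2" using \<open>0 < \<epsilon>\<close> by (simp add: field_simps)
    then have "\<epsilon> * real T \<le> 1" using ln_2_less_1 by linarith
    then have "(0.5 * \<epsilon> * \<beta> * D\<^sup>2) * (\<epsilon> * real T) \<le> 0.5 * \<epsilon> * \<beta> * D\<^sup>2"
      using \<open>0 < \<epsilon>\<close> \<open>\<beta> > 0\<close> by (intro mult_left_le) auto
    then have "C * real T \<le> 0.5 * \<epsilon> * \<beta> * D\<^sup>2"
      by (simp add: C_def power2_eq_square mult_ac)
    moreover have "(1 / 4 - 3 * \<epsilon>) * M \<le> (1 - 2 * \<epsilon>) ^ (T - 1) * ((1 + \<epsilon>) ^ T - 1) * M"
      using quarter_minus_three_epsilon_le[OF \<open>0 < \<epsilon>\<close> True T] M0 by (rule mult_right_mono)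
    moreover have "(1 / 4 - 3 * \<epsilon>) * (1 - m) * F opt = (1 / 4 - 3 * \<epsilon>) * M"
      by (simp add: M_def)
    ultimately show ?thesis using main True by linarith
  next
    case False
    then have "(1 / 4 - 3 * \<epsilon>) * M \<le> 0"
      using M0 by (intro mult_nonpos_nonneg) auto
    moreover have "0 \<le> 0.5 * \<epsilon> * \<beta> * D\<^sup>2" using \<open>0 < \<epsilon>\<close> \<open>\<beta> > 0\<close> by simp
    moreover have "(1 / 4 - 3 * \<epsilon>) * (1 - m) * F opt = (1 / 4 - 3 * \<epsilon>) * M"
      by (simp add: M_def)
    ultimately show ?thesis using assms(5)[OF cube[OF wK]] by linarith
  qed
  show ?thesis unfolding m using wK first second by blast
qed

end
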